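(* Let $n\ge 2$. The number of orbits of size $n+3$ of rowmotion on $\mathcal{IC}([2]\times[n])$ is at least $(n^3-n^2-4n+12)/12$ when $n\equiv0\pmod 6$; $(n^3-n^2-7n+19)/12$ when $n\equiv1\pmod6$; $(n^3-n^2-4n+16)/12$ when $n\equiv2\pmod6$; $(n^3-n^2-7n+15)/12$ when $n\equiv3\pmod6$; $(n^3-n^2-4n+16)/12$ when $n\equiv4\pmod6$; and $(n^3-n^2-7n+19)/12$ when $n\equiv5\pmod6$.
   Context: $[2]\times[n]=\{(i,j): i\in\{1,2\},1\le j\le n\}$ with the componentwise order. An interval-closed set (ICS) is a subset $I$ with $x,y\in I$, $x\le z\le y\Rightarrow z\in I$; $\mathcal{IC}(P)$ is the set of ICS. The toggle $t_x$ sends $I$ to $I\triangle\{x\}$ if this is an ICS, and to $I$ otherwise. Rowmotion is $\mathrm{Row}=t_{x_1}\circ\cdots\circ t_{x_N}$ for any linear extension $x_1,\dots,x_N$ of the poset (toggles applied top to bottom). *)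

theory Defs
  imports Complex_Main "HOL-Library.Product_Order" "HOL-Combinatorics.Orbits"
begin

text \<open>
  A finite poset is a finite set \<open>P\<close> of elements of an ordered type, with the induced order.
\<close>

definition interval_closed_sets :: "'a::order set \<Rightarrow> 'a set set" where
  "interval_closed_sets P =
     {I. I \<subseteq> P \<and> (\<forall>x\<in>I. \<forall>y\<in>I. \<forall>z\<in>P. x \<le> z \<and> z \<le> y \<longrightarrow> z \<in> I)}"

definition linear_extension :: "'a::order set \<Rightarrow> 'a list \<Rightarrow> bool" where
  "linear_extension P xs \<longleftrightarrow>
     distinct xs \<and> set xs = P \<and>
     (\<forall>i<length xs. \<forall>j<length xs. xs ! i < xs ! j \<longrightarrow> i < j)"

definition toggle :: "'a::order set \<Rightarrow> 'a \<Rightarrow> 'a set \<Rightarrow> 'a set" where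
  "toggle P x I =
     (if sym_diff I {x} \<in> interval_closed_sets P then sym_diff I {x} else I)"

text \<open>
  For \<open>xs = [x\<^sub>1, \<dots>, x\<^sub>N]\<close> this is
  \<open>toggle P x\<^sub>1 \<circ> \<dots> \<circ> toggle P x\<^sub>N\<close>, so if \<open>xs\<close> is a linear extension,
  the maximal elements are toggled first.
\<close>

definition rowmotion :: "'a::order set \<Rightarrow> 'a list \<Rightarrow> 'a set \<Rightarrow> 'a set" where
  "rowmotion P xs = foldr (toggle P) xs"

text \<open>
  The library's \<^const>\<open>orbit\<close> is the forward orbit \<open>{f x, f (f x), \<dots>}\<close>. Each toggle is an
  involution on the finite set of interval-closed sets, so rowmotion permutes that set and
  the forward orbit of an interval-closed set is its full orbit.
\<close>

definition rowmotion_orbits :: "'a::order set \<Rightarrow> 'a list \<Rightarrow> 'a set set set" where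
  "rowmotion_orbits P xs = orbit (rowmotion P xs) ` interval_closed_sets P"

definition num_rowmotion_orbits :: "'a::order set \<Rightarrow> 'a list \<Rightarrow> nat \<Rightarrow> nat" where
  "num_rowmotion_orbits P xs k = card {B \<in> rowmotion_orbits P xs. card B = k}"

text \<open>The order on pairs is the componentwise one of \<^theory>\<open>HOL-Library.Product_Order\<close>.\<close>

definition rectangle_poset :: "nat \<Rightarrow> nat \<Rightarrow> (nat \<times> nat) set" where
  "rectangle_poset m n = {1..m} \<times> {1..n}"

end

theory Submission
  imports Defs
begin

text \<open>
  A generic interval-closed set of \<open>[2] \<times> [n]\<close> is a pair of intervals \<open>{a..b}\<close>, \<open>{c..d}\<close>, one per row,
  with \<open>d < a\<close> or \<open>c \<le> a \<le> d \<le> b\<close>, and rowmotion moves both intervals one step to the right except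
  when an end point reaches \<open>n\<close> or two end points meet. The aligned sets with \<open>a = c\<close> and \<open>b < n\<close> are taken
  as markers. Starting at a marker with \<open>d < b\<close>, described by \<open>(A, P, B, Q)\<close> with
  \<open>A + P + B + Q = n - 1\<close>, the orbit first meets another marker after \<open>B + P + 2\<close> steps, namely
  \<open>(B, Q, A, P)\<close>. Starting at a marker with \<open>d = b\<close>, described by \<open>(x, y, z)\<close> with \<open>x + y + z = n\<close>, it
  first meets another marker after \<open>y + 1\<close> steps, namely \<open>(z, x, y)\<close>. Hence these orbits have \<open>n + 3\<close>
  elements unless the tuple is fixed by the half turn or the rotation, and each orbit contains only the 2 or 3
  cyclic shifts of its tuple. Together with the orbit of \<open>{(2, n)}\<close> this gives at least
  \<open>1 + (C(n, 3) - s) / 2 + (C(n - 1, 2) - t) / 3\<close> orbits of size \<open>n + 3\<close>, where \<open>s\<close> and \<open>t\<close> count the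
  symmetric tuples: \<open>s = (n - 1) / 2\<close> for odd \<open>n\<close>, \<open>t = 1\<close> for \<open>3\<close> dividing \<open>n\<close>, and \<open>0\<close> otherwise.
\<close>

section \<open>Rowmotion determined by a local rule\<close>

text \<open>Removing \<open>x\<close> fails exactly when \<open>x\<close> lies strictly between two
  members, and inserting \<open>x\<close> fails exactly when some element between \<open>x\<close>
  and a member is missing. Apart from \<open>x\<close> itself, the criterion consults
  \<open>J\<close> only at elements strictly above or strictly below \<open>x\<close>.\<close>

lemma mem_toggle_self:
  assumes "J \<in> interval_closed_sets P" "x \<in> P"
  shows "x \<in> toggle P x J \<longleftrightarrow>
    (if x \<in> J then \<exists>y\<in>J. \<exists>z\<in>J. y < x \<and> x < z
     else (\<forall>y\<in>J. \<forall>z\<in>P. y < z \<and> z < x \<longrightarrow> z \<in> J) \<and>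
          (\<forall>y\<in>J. \<forall>z\<in>P. x < z \<and> z < y \<longrightarrow> z \<in> J))"
proof (cases "x \<in> J")
  case True
  have conv: "z \<in> J" if "u \<in> J" "v \<in> J" "z \<in> P" "u \<le> z" "z \<le> v" for u v z
    using assms(1) that unfolding interval_closed_sets_def by blast
  have sd: "sym_diff J {x} = J - {x}" using True by auto
  have "J - {x} \<in> interval_closed_sets P \<longleftrightarrow> \<not> (\<exists>y\<in>J. \<exists>z\<in>J. y < x \<and> x < z)"
  proof
    assume l: "J - {x} \<in> interval_closed_sets P"
    have "x \<in> J - {x}" if "y \<in> J" "z \<in> J" "y < x" "x < z" for y z
    proof -
      have "y \<in> J - {x}" "z \<in> J - {x}" "y \<le> x" "x \<le> z" using that by auto
      then show ?thesis using l assms(2) unfolding interval_closed_sets_def by blast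
    qed
    then show "\<not> (\<exists>y\<in>J. \<exists>z\<in>J. y < x \<and> x < z)" by blast
  next
    assume r: "\<not> (\<exists>y\<in>J. \<exists>z\<in>J. y < x \<and> x < z)"
    have "z \<in> J - {x}" if "u \<in> J - {x}" "v \<in> J - {x}" "z \<in> P" "u \<le> z \<and> z \<le> v" for u v z
      using that r conv[of u v z] by (auto simp: less_le)
    moreover have "J - {x} \<subseteq> P" using assms(1) unfolding interval_closed_sets_def by blast
    ultimately show "J - {x} \<in> interval_closed_sets P"
      unfolding interval_closed_sets_def mem_Collect_eq by blast
  qed
  moreover have "x \<in> toggle P x J \<longleftrightarrow> J - {x} \<notin> interval_closed_sets P"
    using True unfolding toggle_def sd by simp
  ultimately show ?thesis using True by simp
next
  case False
  have conv: "z \<in> J" if "u \<in> J" "v \<in> J" "z \<in> P" "u \<le> z" "z \<le> v" for u v z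
    using assms(1) that unfolding interval_closed_sets_def by blast
  have sub: "J \<subseteq> P" using assms(1) unfolding interval_closed_sets_def by blast
  have sd: "sym_diff J {x} = insert x J" using False by auto
  have "insert x J \<in> interval_closed_sets P \<longleftrightarrow>
      (\<forall>y\<in>J. \<forall>z\<in>P. y < z \<and> z < x \<longrightarrow> z \<in> J) \<and>
      (\<forall>y\<in>J. \<forall>z\<in>P. x < z \<and> z < y \<longrightarrow> z \<in> J)" (is "?L \<longleftrightarrow> ?R")
  proof
    assume ?L
    then show ?R unfolding interval_closed_sets_def by (auto simp: less_le)
  next
    assume r: ?R
    have "z \<in> insert x J" if z: "u \<in> insert x J" "v \<in> insert x J" "z \<in> P" "u \<le> z \<and> z \<le> v" for u v z
    proof (cases "u \<in> J \<and> v \<in> J")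
      case True
      then show ?thesis using conv z by blast
    next
      case False
      then have "u = x \<or> v = x" using z by blast
      then consider "z = x" | "z = u" | "z = v" | "u = x" "v \<in> J" "x < z" "z < v" | "v = x" "u \<in> J" "u < z" "z < x"
        using z False by (metis antisym insert_iff le_less)
      then show ?thesis
      proof cases
        case 4
        then show ?thesis using r z(3) by blast
      next
        case 5
        then show ?thesis using r z(3) by blast
      qed (use z in blast)+
    qed
    moreover have "insert x J \<subseteq> P" using sub assms(2) by blast
    ultimately show ?L unfolding interval_closed_sets_def mem_Collect_eq insert_iff by blast
  qed
  moreover have "x \<in> toggle P x J \<longleftrightarrow> insert x J \<in> interval_closed_sets P"
    using False unfolding toggle_def sd by simp
  ultimately show ?thesis using False by simp
qed

lemma mem_toggle_other: "y \<noteq> x \<Longrightarrow> y \<in> toggle P x J \<longleftrightarrow> y \<in> J"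
  unfolding toggle_def by auto

lemma toggle_ICS: "J \<in> interval_closed_sets P \<Longrightarrow> toggle P x J \<in> interval_closed_sets P"
  unfolding toggle_def by auto

text \<open>When \<open>x\<close> is toggled, the elements above it already have their final status in \<open>K\<close> and
  those below it still have their initial status in \<open>I\<close>; the others are irrelevant. Hence the
  result does not depend on the linear extension.\<close>

lemma rowmotion_eqI:
  assumes lin: "linear_extension P xs" and I: "I \<in> interval_closed_sets P" and K: "K \<subseteq> P"
    and step: "\<And>x. x \<in> P \<Longrightarrow> x \<in> K \<longleftrightarrow>
      (if x \<in> I then \<exists>y\<in>I. \<exists>z\<in>K. y < x \<and> x < z
       else (\<forall>y\<in>I. \<forall>z\<in>P. y < z \<and> z < x \<longrightarrow> z \<in> I) \<and>
            (\<forall>y\<in>K. \<forall>z\<in>P. x < z \<and> z < y \<longrightarrow> z \<in> K))"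
  shows "rowmotion P xs I = K"
proof -
  have IP: "I \<subseteq> P" using I unfolding interval_closed_sets_def by blast
  \<comment> \<open>Invariant: once the suffix \<open>zs\<close> has been toggled, the state agrees
    with \<open>K\<close> on \<open>zs\<close> and still with \<open>I\<close> on the rest.\<close>
  have "foldr (toggle P) zs I = (K \<inter> set zs) \<union> (I \<inter> set ys) \<and>
      foldr (toggle P) zs I \<in> interval_closed_sets P" if "xs = ys @ zs" for ys zs
    using that
  proof (induction zs arbitrary: ys)
    case Nil
    then show ?case using lin I IP unfolding linear_extension_def by auto
  next
    case (Cons x zs)
    define J where "J = foldr (toggle P) zs I"
    have J: "J = (K \<inter> set zs) \<union> (I \<inter> set (ys @ [x]))" "J \<in> interval_closed_sets P"
      using Cons.IH[of "ys @ [x]"] Cons.prems unfolding J_def by auto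
    have dist: "distinct xs" and set: "set xs = P"
      and ord: "\<And>i j. i < length xs \<Longrightarrow> j < length xs \<Longrightarrow> xs ! i < xs ! j \<Longrightarrow> i < j"
      using lin unfolding linear_extension_def by auto
    have x: "x \<in> P" "x \<notin> set zs" "x \<notin> set ys" "set ys \<inter> set zs = {}"
      using Cons.prems dist set by auto
    have P: "P = set ys \<union> {x} \<union> set zs" using Cons.prems set by auto
    have xi: "xs ! length ys = x" using Cons.prems by simp
    \<comment> \<open>Being in \<open>ys\<close> or \<open>zs\<close> means having a position before
      or after that of \<open>x\<close>, so the order condition on positions puts elements above
      \<open>x\<close> into \<open>zs\<close> and those below into \<open>ys\<close>.\<close>
    have idx: "\<exists>i. i < length xs \<and> xs ! i = y \<and> (y \<in> set ys \<longleftrightarrow> i < length ys)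
                \<and> (y \<in> set zs \<longleftrightarrow> length ys < i)" if y: "y \<in> P" for y
    proof -
      obtain i where i: "i < length xs" "xs ! i = y"
        using y set in_set_conv_nth[of y xs] by auto
      consider "i < length ys" | "i = length ys" | "length ys < i" by linarith
      then show ?thesis
      proof cases
        case 1
        then have "y = ys ! i" using i(2) Cons.prems by (simp add: nth_append)
        then have "y \<in> set ys" using 1 by simp
        then show ?thesis using 1 i x(4) by auto
      next
        case 2
        then have "y = x" using i(2) xi by simp
        then show ?thesis using 2 i x(2,3) by auto
      next
        case 3
        then have "y = zs ! (i - length ys - 1)" "i - length ys - 1 < length zs"
          using i Cons.prems by (auto simp: nth_append nth_Cons')
        then have "y \<in> set zs" by simp
        then show ?thesis using 3 i x(4) by auto
      qed
    qed
    have above: "y \<in> set zs" if y: "y \<in> P" "x < y" for y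
    proof -
      obtain i where i: "i < length xs" "xs ! i = y" "y \<in> set zs \<longleftrightarrow> length ys < i"
        using idx[OF y(1)] by blast
      moreover have "length ys < length xs" using Cons.prems by simp
      ultimately show ?thesis using ord[of "length ys" i] xi y(2) by simp
    qed
    have below: "y \<in> set ys" if y: "y \<in> P" "y < x" for y
    proof -
      obtain i where i: "i < length xs" "xs ! i = y" "y \<in> set ys \<longleftrightarrow> i < length ys"
        using idx[OF y(1)] by blast
      moreover have "length ys < length xs" using Cons.prems by simp
      ultimately show ?thesis using ord[of i "length ys"] xi y(2) by simp
    qed
    have JP: "J \<subseteq> P" using J(2) unfolding interval_closed_sets_def by blast
    have Ja: "y \<in> J \<longleftrightarrow> y \<in> K" if y: "x < y" for y
    proof (cases "y \<in> P")
      case True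
      then have "y \<in> set zs" "y \<notin> set (ys @ [x])" using above y x by auto
      then show ?thesis using J(1) by blast
    next
      case False
      then show ?thesis using JP K by blast
    qed
    have Jb: "y \<in> J \<longleftrightarrow> y \<in> I" if y: "y < x" for y
    proof (cases "y \<in> P")
      case True
      then have "y \<in> set (ys @ [x])" "y \<notin> set zs" using below y x by auto
      then show ?thesis using J(1) by blast
    next
      case False
      then show ?thesis using JP IP by blast
    qed
    have Jx: "x \<in> J \<longleftrightarrow> x \<in> I" using J(1) x by auto
    have "(if x \<in> J then \<exists>y\<in>J. \<exists>z\<in>J. y < x \<and> x < z
     else (\<forall>y\<in>J. \<forall>z\<in>P. y < z \<and> z < x \<longrightarrow> z \<in> J) \<and>
          (\<forall>y\<in>J. \<forall>z\<in>P. x < z \<and> z < y \<longrightarrow> z \<in> J)) \<longleftrightarrow>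
     (if x \<in> I then \<exists>y\<in>I. \<exists>z\<in>K. y < x \<and> x < z
       else (\<forall>y\<in>I. \<forall>z\<in>P. y < z \<and> z < x \<longrightarrow> z \<in> I) \<and>
            (\<forall>y\<in>K. \<forall>z\<in>P. x < z \<and> z < y \<longrightarrow> z \<in> K))"
    proof (cases "x \<in> I")
      case True
      then show ?thesis using Ja Jb Jx by auto
    next
      case False
      \<comment> \<open>By transitivity both \<open>y\<close> and \<open>z\<close> are below
        \<open>x\<close>, where \<open>J\<close> and \<open>I\<close> agree; the upper half is the
        same with \<open>K\<close>.\<close>
      have "(\<forall>y\<in>J. \<forall>z\<in>P. y < z \<and> z < x \<longrightarrow> z \<in> J) \<longleftrightarrow>
        (\<forall>y\<in>I. \<forall>z\<in>P. y < z \<and> z < x \<longrightarrow> z \<in> I)"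
        by (meson Jb less_trans)
      moreover have "(\<forall>y\<in>J. \<forall>z\<in>P. x < z \<and> z < y \<longrightarrow> z \<in> J) \<longleftrightarrow>
        (\<forall>y\<in>K. \<forall>z\<in>P. x < z \<and> z < y \<longrightarrow> z \<in> K)"
        by (meson Ja less_trans)
      ultimately show ?thesis using False Jx by simp
    qed
    then have "x \<in> toggle P x J \<longleftrightarrow> x \<in> K"
      using step[OF x(1)] mem_toggle_self[OF J(2) x(1)] by simp
    moreover have "y \<in> toggle P x J \<longleftrightarrow> y \<in> (K \<inter> set zs) \<union> (I \<inter> set ys)" if "y \<noteq> x" for y
      using mem_toggle_other[OF that] J(1) that by auto
    moreover have "y \<in> (K \<inter> set (x # zs)) \<union> (I \<inter> set ys) \<longleftrightarrow>
        (if y = x then x \<in> K else y \<in> (K \<inter> set zs) \<union> (I \<inter> set ys))" for y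
      using x by auto
    ultimately have "toggle P x J = (K \<inter> set (x # zs)) \<union> (I \<inter> set ys)"
      by (intro set_eqI) metis
    moreover have "foldr (toggle P) (x # zs) I = toggle P x J" by (simp add: J_def)
    ultimately show ?case using toggle_ICS[OF J(2), of x] by metis
  qed
  from this[of "[]" xs] show ?thesis
    using lin K unfolding rowmotion_def linear_extension_def by auto
qed

section \<open>Interval-closed sets of a two-row rectangle\<close>

text \<open>Right end smaller than left end encodes an empty row; for instance
  \<open>two_rows 1 0 n n\<close> is the singleton of \<open>(2, n)\<close>.\<close>

definition two_rows :: "nat \<Rightarrow> nat \<Rightarrow> nat \<Rightarrow> nat \<Rightarrow> (nat \<times> nat) set" where
  "two_rows a b c d = {1} \<times> {a..b} \<union> {2} \<times> {c..d}"

lemma mem_two_rows: "(i, j) \<in> two_rows a b c d \<longleftrightarrow>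
    i = 1 \<and> a \<le> j \<and> j \<le> b \<or> i = 2 \<and> c \<le> j \<and> j \<le> d"
  unfolding two_rows_def by auto

lemma ball_two_rows: "(\<forall>x\<in>two_rows a b c d. p x) \<longleftrightarrow>
    (\<forall>j. a \<le> j \<and> j \<le> b \<longrightarrow> p (1, j)) \<and> (\<forall>j. c \<le> j \<and> j \<le> d \<longrightarrow> p (2, j))"
  unfolding two_rows_def by auto

lemma bex_two_rows: "(\<exists>x\<in>two_rows a b c d. p x) \<longleftrightarrow>
    (\<exists>j. a \<le> j \<and> j \<le> b \<and> p (1, j)) \<or> (\<exists>j. c \<le> j \<and> j \<le> d \<and> p (2, j))"
  unfolding two_rows_def by auto

lemma rectangle_two_rows: "rectangle_poset 2 n = two_rows 1 n 1 n"
  unfolding two_rows_def rectangle_poset_def by (auto simp: le_Suc_eq numeral_2_eq_2)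

text \<open>If both rows are nonempty, they interact only when \<open>(1, a)\<close> is below
  \<open>(2, d)\<close>, that is \<open>a \<le> d\<close>. Then all columns from \<open>a\<close> to
  \<open>d\<close> are forced in both rows, which means \<open>d \<le> b\<close> and
  \<open>c \<le> a\<close>.\<close>

lemma two_rows_ICS:
  assumes "1 \<le> a" "b \<le> n" "1 \<le> c" "d \<le> n" "b < a \<or> d < c \<or> d < a \<or> c \<le> a \<and> d \<le> b"
  shows "two_rows a b c d \<in> interval_closed_sets (rectangle_poset 2 n)"
  using assms unfolding interval_closed_sets_def rectangle_two_rows
  by (auto simp: ball_two_rows mem_two_rows subset_iff)

lemma two_rows_less:
  "(1::nat, j::nat) < (1, k) \<longleftrightarrow> j < k" "(1::nat, j) < (2, k) \<longleftrightarrow> j \<le> k"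
  "(2::nat, j) < (1, k) \<longleftrightarrow> False" "(2::nat, j) < (2, k) \<longleftrightarrow> j < k"
  by (auto simp: less_le_not_le)

lemma two_rows_mem:
  "(1, j) \<in> two_rows a b c d \<longleftrightarrow> a \<le> j \<and> j \<le> b" "(2, j) \<in> two_rows a b c d \<longleftrightarrow> c \<le> j \<and> j \<le> d"
  unfolding two_rows_def by auto

lemma two_rows_eq_iff:
  assumes "a \<le> b" "c \<le> d"
  shows "two_rows a b c d = two_rows a' b' c' d' \<longleftrightarrow> a = a' \<and> b = b' \<and> c = c' \<and> d = d'"
proof
  assume eq: "two_rows a b c d = two_rows a' b' c' d'"
  have "{j. (1, j) \<in> two_rows a b c d} = {a..b}" "{j. (2, j) \<in> two_rows a b c d} = {c..d}" for a b c d
    unfolding two_rows_mem by auto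
  then have "{a..b} = {a'..b'}" "{c..d} = {c'..d'}" using eq by metis+
  then show "a = a' \<and> b = b' \<and> c = c' \<and> d = d'" using assms by (simp add: Icc_eq_Icc)
qed simp

text \<open>\<open>row1\<close> and \<open>row2\<close> are the local rule of
  \<open>rowmotion_eqI\<close> with its quantifiers over elements eliminated by testing extreme and
  neighbouring columns. What remains is linear in the column \<open>j\<close>, so concrete steps
  become automatic. Guards such as \<open>a' \<le> b'\<close> take care of empty rows.\<close>

lemma rowmotion_two_rows:
  assumes lin: "linear_extension (rectangle_poset 2 n) xs"
    and bnd: "1 \<le> a" "b \<le> n" "1 \<le> c" "d \<le> n" "b < a \<or> d < c \<or> d < a \<or> c \<le> a \<and> d \<le> b"
    and bnd': "1 \<le> a'" "b' \<le> n" "1 \<le> c'" "d' \<le> n"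
    and row1: "\<And>j. 1 \<le> j \<Longrightarrow> j \<le> n \<Longrightarrow> a' \<le> j \<and> j \<le> b' \<longleftrightarrow>
      (if a \<le> j \<and> j \<le> b then a < j \<and> (a' \<le> b' \<and> j < b' \<or> c' \<le> d' \<and> j \<le> d')
       else (a \<le> b \<and> a \<le> j \<longrightarrow> j = b + 1) \<and> (a' \<le> b' \<and> j \<le> b' \<longrightarrow> a' \<le> j + 1) \<and>
         (c' \<le> d' \<and> j < d' \<longrightarrow> a' \<le> j + 1 \<and> d' \<le> b' \<and> c' \<le> j))"
    and row2: "\<And>j. 1 \<le> j \<Longrightarrow> j \<le> n \<Longrightarrow> c' \<le> j \<and> j \<le> d' \<longleftrightarrow>
      (if c \<le> j \<and> j \<le> d then c' \<le> d' \<and> j < d' \<and> (c < j \<or> a \<le> b \<and> a \<le> j)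
       else (c' \<le> d' \<and> j \<le> d' \<longrightarrow> c' \<le> j + 1) \<and> (c \<le> d \<and> c \<le> j \<longrightarrow> j = d + 1) \<and>
         (a \<le> b \<and> a < j \<longrightarrow> j \<le> b \<and> c \<le> a \<and> j \<le> d + 1))"
  shows "rowmotion (rectangle_poset 2 n) xs (two_rows a b c d) = two_rows a' b' c' d'"
proof (rule rowmotion_eqI[OF lin two_rows_ICS[OF bnd]])
  show "two_rows a' b' c' d' \<subseteq> rectangle_poset 2 n"
    using bnd' unfolding rectangle_two_rows two_rows_def by auto
next
  fix x assume "x \<in> rectangle_poset 2 n"
  then consider (r1) j where "x = (1, j)" "1 \<le> j" "j \<le> n" | (r2) j where "x = (2, j)" "1 \<le> j" "j \<le> n"
    unfolding rectangle_two_rows two_rows_def by auto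
  then show "x \<in> two_rows a' b' c' d' \<longleftrightarrow>
      (if x \<in> two_rows a b c d
       then \<exists>y\<in>two_rows a b c d. \<exists>z\<in>two_rows a' b' c' d'. y < x \<and> x < z
       else (\<forall>y\<in>two_rows a b c d. \<forall>z\<in>rectangle_poset 2 n. y < z \<and> z < x \<longrightarrow> z \<in> two_rows a b c d) \<and>
            (\<forall>y\<in>two_rows a' b' c' d'. \<forall>z\<in>rectangle_poset 2 n. x < z \<and> z < y \<longrightarrow> z \<in> two_rows a' b' c' d'))"
    (is "_ \<longleftrightarrow> (if _ then ?E else ?L \<and> ?U)")
  proof cases
    case (r1 j)
    have E: "?E \<longleftrightarrow> a < j \<and> (a' \<le> b' \<and> j < b' \<or> c' \<le> d' \<and> j \<le> d')" if "a \<le> j \<and> j \<le> b"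
    proof -
      have "?E \<longleftrightarrow> (\<exists>k. a \<le> k \<and> k \<le> b \<and> k < j) \<and>
          ((\<exists>k. a' \<le> k \<and> k \<le> b' \<and> j < k) \<or> (\<exists>k. c' \<le> k \<and> k \<le> d' \<and> j \<le> k))"
        unfolding bex_two_rows r1(1) two_rows_less by blast
      also have "(\<exists>k. a \<le> k \<and> k \<le> b \<and> k < j) \<longleftrightarrow> a < j" using that by (auto intro: exI[of _ a])
      also have "(\<exists>k. a' \<le> k \<and> k \<le> b' \<and> j < k) \<longleftrightarrow> a' \<le> b' \<and> j < b'" by (auto intro: exI[of _ b'])
      also have "(\<exists>k. c' \<le> k \<and> k \<le> d' \<and> j \<le> k) \<longleftrightarrow> c' \<le> d' \<and> j \<le> d'" by (auto intro: exI[of _ d'])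
      finally show ?thesis .
    qed
    have L: "?L \<longleftrightarrow> (a \<le> b \<and> a \<le> j \<longrightarrow> j = b + 1)" if "\<not> (a \<le> j \<and> j \<le> b)"
    proof -
      have "?L \<longleftrightarrow> (\<forall>k. a \<le> k \<and> k \<le> b \<longrightarrow> (\<forall>l. 1 \<le> l \<and> l \<le> n \<longrightarrow> k < l \<and> l < j \<longrightarrow> a \<le> l \<and> l \<le> b))"
        unfolding ball_two_rows rectangle_two_rows r1(1) two_rows_less two_rows_mem by blast
      also have "\<dots> \<longleftrightarrow> (a \<le> b \<and> a \<le> j \<longrightarrow> j = b + 1)"
      proof
        assume h: "\<forall>k. a \<le> k \<and> k \<le> b \<longrightarrow> (\<forall>l. 1 \<le> l \<and> l \<le> n \<longrightarrow> k < l \<and> l < j \<longrightarrow> a \<le> l \<and> l \<le> b)"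
        \<comment> \<open>If \<open>j\<close> were larger than \<open>b + 1\<close>, then
          \<open>(1, b + 1)\<close> would be a missing element between \<open>(1, b)\<close> and
          \<open>(1, j)\<close>.\<close>
        show "a \<le> b \<and> a \<le> j \<longrightarrow> j = b + 1"
          using h[rule_format, of b "b + 1"] that r1(2,3) by presburger
      qed (use that in auto)
      finally show ?thesis .
    qed
    have U: "?U \<longleftrightarrow> (a' \<le> b' \<and> j \<le> b' \<longrightarrow> a' \<le> j + 1) \<and>
         (c' \<le> d' \<and> j < d' \<longrightarrow> a' \<le> j + 1 \<and> d' \<le> b' \<and> c' \<le> j)"
    proof -
      have "?U \<longleftrightarrow> (\<forall>k. a' \<le> k \<and> k \<le> b' \<longrightarrow> (\<forall>l. 1 \<le> l \<and> l \<le> n \<longrightarrow> j < l \<and> l < k \<longrightarrow> a' \<le> l \<and> l \<le> b')) \<and>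
          (\<forall>k. c' \<le> k \<and> k \<le> d' \<longrightarrow> (\<forall>l. 1 \<le> l \<and> l \<le> n \<longrightarrow> j < l \<and> l \<le> k \<longrightarrow> a' \<le> l \<and> l \<le> b') \<and>
             (\<forall>l. 1 \<le> l \<and> l \<le> n \<longrightarrow> j \<le> l \<and> l < k \<longrightarrow> c' \<le> l \<and> l \<le> d'))" (is "_ \<longleftrightarrow> ?h")
        unfolding ball_two_rows rectangle_two_rows r1(1) two_rows_less two_rows_mem by blast
      also have "?h \<longleftrightarrow> (a' \<le> b' \<and> j \<le> b' \<longrightarrow> a' \<le> j + 1) \<and>
         (c' \<le> d' \<and> j < d' \<longrightarrow> a' \<le> j + 1 \<and> d' \<le> b' \<and> c' \<le> j)"
      proof
        assume h: ?h
        have "a' \<le> j + 1" if "a' \<le> b'" "j \<le> b'"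
          using h[THEN conjunct1, rule_format, of b' "j + 1"] that r1(2,3) bnd' by linarith
        moreover have "a' \<le> j + 1 \<and> d' \<le> b' \<and> c' \<le> j" if "c' \<le> d'" "j < d'"
        proof (intro conjI)
          \<comment> \<open>The elements tested between \<open>(1, j)\<close> and
            \<open>(2, d')\<close> are \<open>(1, j + 1)\<close>, \<open>(1, d')\<close> and
            \<open>(2, j)\<close>, in this order.\<close>
          show "a' \<le> j + 1"
            using h[THEN conjunct2, rule_format, of d', THEN conjunct1, rule_format, of "j + 1"] that r1(2,3) bnd' by linarith
          show "d' \<le> b'"
            using h[THEN conjunct2, rule_format, of d', THEN conjunct1, rule_format, of d'] that r1(2,3) bnd' by linarith
          show "c' \<le> j"
            using h[THEN conjunct2, rule_format, of d', THEN conjunct2, rule_format, of j] that r1(2,3) bnd' by linarith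
        qed
        ultimately show "(a' \<le> b' \<and> j \<le> b' \<longrightarrow> a' \<le> j + 1) \<and>
         (c' \<le> d' \<and> j < d' \<longrightarrow> a' \<le> j + 1 \<and> d' \<le> b' \<and> c' \<le> j)" by blast
      qed auto
      finally show ?thesis .
    qed
    show ?thesis using row1[OF r1(2,3)] E L U by (simp add: r1(1) mem_two_rows)
  next
    case (r2 j)
    have E: "?E \<longleftrightarrow> c' \<le> d' \<and> j < d' \<and> (c < j \<or> a \<le> b \<and> a \<le> j)" if "c \<le> j \<and> j \<le> d"
    proof -
      have "?E \<longleftrightarrow> ((\<exists>k. c \<le> k \<and> k \<le> d \<and> k < j) \<or> (\<exists>k. a \<le> k \<and> k \<le> b \<and> k \<le> j)) \<and>
          (\<exists>k. c' \<le> k \<and> k \<le> d' \<and> j < k)"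
        unfolding bex_two_rows r2(1) two_rows_less by blast
      also have "(\<exists>k. c \<le> k \<and> k \<le> d \<and> k < j) \<longleftrightarrow> c < j" using that by (auto intro: exI[of _ c])
      also have "(\<exists>k. a \<le> k \<and> k \<le> b \<and> k \<le> j) \<longleftrightarrow> a \<le> b \<and> a \<le> j" by (auto intro: exI[of _ a])
      also have "(\<exists>k. c' \<le> k \<and> k \<le> d' \<and> j < k) \<longleftrightarrow> c' \<le> d' \<and> j < d'" by (auto intro: exI[of _ d'])
      finally show ?thesis by blast
    qed
    have U: "?U \<longleftrightarrow> (c' \<le> d' \<and> j \<le> d' \<longrightarrow> c' \<le> j + 1)"
    proof -
      have "?U \<longleftrightarrow> (\<forall>k. c' \<le> k \<and> k \<le> d' \<longrightarrow> (\<forall>l. 1 \<le> l \<and> l \<le> n \<longrightarrow> j < l \<and> l < k \<longrightarrow> c' \<le> l \<and> l \<le> d'))"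
        (is "_ \<longleftrightarrow> ?h")
        unfolding ball_two_rows rectangle_two_rows r2(1) two_rows_less two_rows_mem by blast
      also have "?h \<longleftrightarrow> (c' \<le> d' \<and> j \<le> d' \<longrightarrow> c' \<le> j + 1)"
      proof
        assume h: ?h
        show "c' \<le> d' \<and> j \<le> d' \<longrightarrow> c' \<le> j + 1"
          using h[rule_format, of d' "j + 1"] r2(2,3) bnd' by linarith
      qed auto
      finally show ?thesis .
    qed
    have L: "?L \<longleftrightarrow> (c \<le> d \<and> c \<le> j \<longrightarrow> j = d + 1) \<and> (a \<le> b \<and> a < j \<longrightarrow> j \<le> b \<and> c \<le> a \<and> j \<le> d + 1)"
      if "\<not> (c \<le> j \<and> j \<le> d)"
    proof -
      have "?L \<longleftrightarrow> (\<forall>k. a \<le> k \<and> k \<le> b \<longrightarrow> (\<forall>l. 1 \<le> l \<and> l \<le> n \<longrightarrow> k < l \<and> l \<le> j \<longrightarrow> a \<le> l \<and> l \<le> b) \<and>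
             (\<forall>l. 1 \<le> l \<and> l \<le> n \<longrightarrow> k \<le> l \<and> l < j \<longrightarrow> c \<le> l \<and> l \<le> d)) \<and>
          (\<forall>k. c \<le> k \<and> k \<le> d \<longrightarrow> (\<forall>l. 1 \<le> l \<and> l \<le> n \<longrightarrow> k < l \<and> l < j \<longrightarrow> c \<le> l \<and> l \<le> d))" (is "_ \<longleftrightarrow> ?h")
        unfolding ball_two_rows rectangle_two_rows r2(1) two_rows_less two_rows_mem by blast
      also have "?h \<longleftrightarrow> (c \<le> d \<and> c \<le> j \<longrightarrow> j = d + 1) \<and>
          (a \<le> b \<and> a < j \<longrightarrow> j \<le> b \<and> c \<le> a \<and> j \<le> d + 1)"
      proof
        assume h: ?h
        have "j = d + 1" if "c \<le> d" "c \<le> j"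
          using h[THEN conjunct2, rule_format, of d "d + 1"] that \<open>\<not> (c \<le> j \<and> j \<le> d)\<close> r2(2,3) bnd by linarith
        moreover have "j \<le> b \<and> c \<le> a \<and> j \<le> d + 1" if "a \<le> b" "a < j"
        proof (intro conjI)
          \<comment> \<open>The elements tested between \<open>(1, a)\<close> and
            \<open>(2, j)\<close> are \<open>(1, j)\<close>, \<open>(2, a)\<close> and
            \<open>(2, j - 1)\<close>, in this order.\<close>
          show "j \<le> b"
            using h[THEN conjunct1, rule_format, of a, THEN conjunct1, rule_format, of j] that r2(2,3) bnd by linarith
          show "c \<le> a"
            using h[THEN conjunct1, rule_format, of a, THEN conjunct2, rule_format, of a] that r2(2,3) bnd by linarith
          show "j \<le> d + 1"
            using h[THEN conjunct1, rule_format, of a, THEN conjunct2, rule_format, of "j - 1"] that r2(2,3) bnd by linarith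
        qed
        ultimately show "(c \<le> d \<and> c \<le> j \<longrightarrow> j = d + 1) \<and>
          (a \<le> b \<and> a < j \<longrightarrow> j \<le> b \<and> c \<le> a \<and> j \<le> d + 1)" by blast
      qed (use that in auto)
      finally show ?thesis .
    qed
    show ?thesis using row2[OF r2(2,3)] E L U by (simp add: r2(1) mem_two_rows) blast
  qed
qed

section \<open>Single steps of rowmotion on pairs of intervals\<close>

locale rectangle_rowmotion =
  fixes n :: nat and xs :: "(nat \<times> nat) list"
  assumes n_ge_2: "2 \<le> n" and lin: "linear_extension (rectangle_poset 2 n) xs"
begin

abbreviation row :: "(nat \<times> nat) set \<Rightarrow> (nat \<times> nat) set" where
  "row \<equiv> rowmotion (rectangle_poset 2 n) xs"

lemma row_disjoint_shift:
  assumes "1 \<le> c" "c \<le> d" "d < a" "a \<le> b" "b < n"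
  shows "row (two_rows a b c d) = two_rows (a + 1) (b + 1) (c + 1) (d + 1)"
  by (rule rowmotion_two_rows[OF lin]) (use assms in auto)

lemma row_disjoint_top:
  assumes "1 \<le> c" "c \<le> d" "d + 1 < a" "a \<le> n"
  shows "row (two_rows a n c d) = two_rows (c + 1) (a - 1) (c + 1) (d + 1)"
  by (rule rowmotion_two_rows[OF lin]) (use assms in auto)

text \<open>\<open>(2, a)\<close> survives because \<open>(1, a)\<close> lies below it and
  \<open>(2, a + 1)\<close> above it; then everything to its left in the second row can be added,
  which moves the left end to 1.\<close>

lemma row_aligned:
  assumes "1 \<le> a" "a \<le> d" "d < b" "b < n"
  shows "row (two_rows a b a d) = two_rows (a + 1) (b + 1) 1 (d + 1)"
  by (rule rowmotion_two_rows[OF lin]) (use assms in auto)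

lemma row_overlap_shift:
  assumes "1 \<le> c" "c < a" "a \<le> d" "d < b" "b < n"
  shows "row (two_rows a b c d) = two_rows (a + 1) (b + 1) (c + 1) (d + 1)"
  by (rule rowmotion_two_rows[OF lin]) (use assms in auto)

text \<open>The first row can no longer move right, and only its elements below the new end
  \<open>(2, d + 1)\<close> are kept. From here on both rows have the same right end.\<close>

lemma row_overlap_top:
  assumes "1 \<le> c" "c < a" "a \<le> d" "d < n"
  shows "row (two_rows a n c d) = two_rows (a + 1) (d + 1) (c + 1) (d + 1)"
  by (rule rowmotion_two_rows[OF lin]) (use assms in auto)

text \<open>\<open>(2, b + 1)\<close> is blocked since \<open>(1, b + 1)\<close> is missing from the
  initial set. So the second row is removed from its right end down to \<open>c\<close>, and the
  columns left of \<open>c\<close> are filled.\<close>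

lemma row_same_end:
  assumes "2 \<le> c" "c \<le> a" "a \<le> b" "b < n"
  shows "row (two_rows a b c b) = two_rows (a + 1) (b + 1) 1 (c - 1)"
  by (rule rowmotion_two_rows[OF lin]) (use assms in auto)

lemma row_same_end_top:
  assumes "2 \<le> c" "c < a" "a \<le> n"
  shows "row (two_rows a n c n) = two_rows 1 (a - 1) 1 (c - 1)"
  by (rule rowmotion_two_rows[OF lin]) (use assms in auto)

text \<open>These five steps fall outside the generic rules: the singleton of \<open>(2, n)\<close>,
  all but \<open>(2, n)\<close>, all but \<open>(1, 1)\<close>, the singleton of
  \<open>(1, 1)\<close>, and the last antichain before the return to \<open>(2, n)\<close>.\<close>

lemma row_exceptional:
  "row (two_rows 1 0 n n) = two_rows 1 n 1 (n - 1)"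
  "row (two_rows 1 n 1 (n - 1)) = two_rows 2 n 1 n"
  "row (two_rows 2 n 1 n) = two_rows 1 1 1 0"
  "row (two_rows 1 1 1 0) = two_rows 2 2 1 1"
  "row (two_rows n n (n - 1) (n - 1)) = two_rows 1 0 n n"
  by (rule rowmotion_two_rows[OF lin]; use n_ge_2 in auto)+

end

section \<open>Returns to the aligned states\<close>

text \<open>The markers cut the orbit into \<open>r\<close> segments of lengths \<open>m i\<close>.
  A shorter period would bring \<open>u 0\<close> back before the end, hence at the start of some
  segment, against injectivity of \<open>u\<close>.\<close>

lemma orbit_markers:
  fixes f :: "'a \<Rightarrow> 'a" and u :: "nat \<Rightarrow> 'a" and m :: "nat \<Rightarrow> nat"
  assumes pos: "0 < r" "\<And>i. i < r \<Longrightarrow> 0 < m i"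
    and step: "\<And>i. i < r \<Longrightarrow> (f ^^ m i) (u i) = u (Suc i)"
    and between: "\<And>i k. i < r \<Longrightarrow> 0 < k \<Longrightarrow> k < m i \<Longrightarrow> (f ^^ k) (u i) \<notin> M"
    and M: "\<And>i. i < r \<Longrightarrow> u i \<in> M"
    and closed: "u r = u 0" and inj: "inj_on u {..<r}"
  shows "card (orbit f (u 0)) = (\<Sum>i<r. m i)" and "orbit f (u 0) \<inter> M = u ` {..<r}"
proof -
  define t where "t j = (\<Sum>i<j. m i)" for j
  define N where "N = t r"
  define s where "s k = (f ^^ k) (u 0)" for k
  have t_Suc: "t (Suc j) = t j + m j" for j by (simp add: t_def)
  have s_add: "s (t j + l) = (f ^^ l) (s (t j))" for j l
    by (simp add: s_def funpow_add add.commute)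
  \<comment> \<open>\<open>t j\<close> is the time of the marker \<open>u j\<close>, and before that
    time \<open>M\<close> is visited only at the earlier times \<open>t i\<close>.\<close>
  have main: "s (t j) = u j \<and> (\<forall>k<t j. s k \<in> M \<longrightarrow> (\<exists>i<j. k = t i))" if "j \<le> r" for j
    using that
  proof (induction j)
    case 0
    then show ?case by (simp add: t_def s_def)
  next
    case (Suc j)
    then have IH: "s (t j) = u j" "\<And>k. k < t j \<Longrightarrow> s k \<in> M \<Longrightarrow> \<exists>i<j. k = t i" and j: "j < r" by auto
    have "s (t (Suc j)) = u (Suc j)" using s_add[of j "m j"] IH(1) step[OF j] by (simp add: t_Suc)
    moreover have "\<exists>i<Suc j. k = t i" if k: "k < t (Suc j)" "s k \<in> M" for k
    proof (cases "k < t j")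
      case True
      then show ?thesis using IH(2) k(2) less_SucI by blast
    next
      case False
      then obtain l where l: "k = t j + l" by (metis le_add_diff_inverse not_less)
      then have "(f ^^ l) (u j) \<in> M" "l < m j" using k s_add[of j l] IH(1) by (auto simp: t_Suc)
      then have "l = 0" using between[OF j, of l] by blast
      then show ?thesis using l by auto
    qed
    ultimately show ?case by blast
  qed
  have "m 0 \<le> N" using member_le_sum[of 0 "{..<r}" m] pos(1) by (simp add: N_def t_def)
  then have N: "0 < N" using pos(2)[OF pos(1)] by linarith
  have sN: "s N = u 0" using main[of r] closed by (simp add: N_def)
  then have s_mod: "s (k mod N) = s k" for k
    unfolding s_def by (rule funpow_mod_eq)
  have orb: "orbit f (u 0) = s ` {..<N}"
  proof
    show "orbit f (u 0) \<subseteq> s ` {..<N}"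
    proof
      fix y assume "y \<in> orbit f (u 0)"
      then obtain k where "y = s k" unfolding orbit_altdef s_def by blast
      then have "y = s (k mod N)" using s_mod by simp
      then show "y \<in> s ` {..<N}" using N by auto
    qed
    \<comment> \<open>\<open>orbit\<close> consists of positive iterates only, so \<open>s 0\<close>
      has to be reached as \<open>s N\<close>.\<close>
    have "s k = s (k + N)" for k using s_mod[of k] s_mod[of "k + N"] by simp
    then show "s ` {..<N} \<subseteq> orbit f (u 0)"
      unfolding orbit_altdef s_def using N by (force simp del: funpow_add)
  qed
  have "False" if ij: "i < j" "j < N" "s i = s j" for i j
  proof -
    \<comment> \<open>Applying \<open>N - j\<close> more steps turns the coincidence of times
      \<open>i\<close> and \<open>j\<close> into a return to \<open>u 0\<close> at a positive time
      below \<open>N\<close>.\<close>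
    have "s (N - j + i) = s (N - j + j)" using ij(3) unfolding s_def by (simp only: funpow_add comp_apply)
    then have eq: "s (N - j + i) = u 0" using ij sN by simp
    then have "s (N - j + i) \<in> M" using M pos(1) by simp
    moreover have lt: "N - j + i < t r" using ij unfolding N_def by linarith
    ultimately obtain i' where i': "i' < r" "N - j + i = t i'"
      using main[of r] lt by (metis le_refl)
    then have "u i' = u 0" using main[of i'] eq by simp
    then have "i' = 0" using inj i'(1) pos(1) by (simp add: inj_on_def)
    then show False using i'(2) ij by (simp add: t_def)
  qed
  then have "inj_on s {..<N}" by (metis inj_onI lessThan_iff nat_neq_iff)
  then show "card (orbit f (u 0)) = (\<Sum>i<r. m i)"
    unfolding orb by (simp add: card_image N_def t_def)
  show "orbit f (u 0) \<inter> M = u ` {..<r}"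
  proof
    show "orbit f (u 0) \<inter> M \<subseteq> u ` {..<r}"
    proof
      fix y assume "y \<in> orbit f (u 0) \<inter> M"
      then obtain k where k: "k < t r" "y = s k" "s k \<in> M" unfolding orb N_def by blast
      then obtain i where "i < r" "k = t i" using main[of r] by blast
      then show "y \<in> u ` {..<r}" using main[of i] k(2) by simp
    qed
    have "u i \<in> orbit f (u 0)" if "i < r" for i
    proof -
      have "u i = s (t i mod N)" using main[of i] that s_mod by simp
      then show ?thesis unfolding orb using N by auto
    qed
    then show "u ` {..<r} \<subseteq> orbit f (u 0) \<inter> M" using M by blast
  qed
qed

section \<open>Markers and first-return times\<close>

context rectangle_rowmotion
begin

text \<open>The inserted set is the singleton of \<open>(2, n)\<close>; it marks an orbit that meets
  none of the aligned sets with \<open>b < n\<close>.\<close>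

definition markers :: "(nat \<times> nat) set set" where
  "markers = insert (two_rows 1 0 n n) {two_rows a b a d | a b d. 1 \<le> a \<and> a \<le> d \<and> d \<le> b \<and> b < n}"

lemma aligned_marker: "1 \<le> a \<Longrightarrow> a \<le> d \<Longrightarrow> d \<le> b \<Longrightarrow> b < n \<Longrightarrow> two_rows a b a d \<in> markers"
  unfolding markers_def by blast

lemma not_marker:
  assumes "a \<le> b" "c \<le> d" "a \<noteq> c \<or> b = n"
  shows "two_rows a b c d \<notin> markers"
  using assms by (auto simp: markers_def two_rows_eq_iff)

text \<open>An aligned state \<open>{a..b}\<close>, \<open>{a..d}\<close> with \<open>d < b < n\<close> is encoded by \<open>A = d - a + 1\<close>,
  \<open>P = b - d - 1\<close>, \<open>B = n - b\<close>, \<open>Q = a - 1\<close>. The next aligned state of its orbit exchanges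
  \<open>(A, P)\<close> and \<open>(B, Q)\<close>.\<close>

definition state4 :: "nat \<times> nat \<times> nat \<times> nat \<Rightarrow> (nat \<times> nat) set" where
  "state4 = (\<lambda>(A, P, B, Q). two_rows (Q + 1) (A + P + Q + 1) (Q + 1) (A + Q))"

context
  fixes A P B Q :: nat
  assumes AB: "1 \<le> A" "1 \<le> B" and sum: "A + P + B + Q + 1 = n"
begin

text \<open>The aligned step sends the left end of the second row to 1, after which both overlapping
  intervals shift until the first row reaches \<open>n\<close> at time \<open>B\<close>.\<close>

lemma state4_phase1:
  "j < B \<Longrightarrow> (row ^^ Suc j) (state4 (A, P, B, Q)) =
     two_rows (Q + 2 + j) (A + P + Q + 2 + j) (1 + j) (A + Q + 1 + j)"
proof (induction j)
  case 0
  then show ?case using row_aligned[of "Q + 1" "A + Q" "A + P + Q + 1"] AB sum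
    by (simp add: state4_def)
next
  case (Suc j)
  then show ?case
    using row_overlap_shift[of "1 + j" "Q + 2 + j" "A + Q + 1 + j" "A + P + Q + 2 + j"] AB sum
    by simp
qed

lemma state4_phase2:
  "(row ^^ Suc B) (state4 (A, P, B, Q)) =
     two_rows (Q + B + 2) (A + Q + B + 1) (B + 1) (A + Q + B + 1)"
proof -
  obtain C where "B = Suc C" using AB by (cases B) auto
  then have "(row ^^ B) (state4 (A, P, B, Q)) = two_rows (Q + B + 1) n B (A + Q + B)"
    using state4_phase1[of C] sum by (simp add: algebra_simps)
  then show ?thesis
    using row_overlap_top[of B "Q + B + 1" "A + Q + B"] AB sum by (simp add: algebra_simps)
qed

text \<open>With equal right ends the second row restarts as the first \<open>B\<close> columns, now
  disjoint from the first row; the shift then lasts until the first row reaches \<open>n\<close> at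
  time \<open>B + P + 1\<close>.\<close>

lemma state4_phase3:
  "i < P \<Longrightarrow> (row ^^ (B + 2 + i)) (state4 (A, P, B, Q)) =
     two_rows (B + Q + 3 + i) (A + B + Q + 2 + i) (1 + i) (B + i)"
proof (induction i)
  case 0
  then show ?case
    using state4_phase2 row_same_end[of "B + 1" "Q + B + 2" "A + Q + B + 1"] AB sum
    by (simp add: algebra_simps numeral_eq_Suc)
next
  case (Suc i)
  then show ?case
    using row_disjoint_shift[of "1 + i" "B + i" "B + Q + 3 + i" "A + B + Q + 2 + i"] AB sum
    by (simp add: algebra_simps numeral_eq_Suc)
qed

lemma state4_return: "(row ^^ (B + P + 2)) (state4 (A, P, B, Q)) = state4 (B, Q, A, P)"
proof (cases P)
  \<comment> \<open>For \<open>P = 0\<close> the common right end is already \<open>n\<close>, so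
    the disjoint phase is empty and \<open>row_same_end_top\<close> leads straight to the next
    marker.\<close>
  case 0
  then show ?thesis
    using state4_phase2 row_same_end_top[of "B + 1" "Q + B + 2"] AB sum
    by (simp add: state4_def algebra_simps numeral_eq_Suc)
next
  case (Suc i)
  then have "(row ^^ (B + P + 1)) (state4 (A, P, B, Q)) = two_rows (B + Q + P + 2) n P (B + P - 1)"
    using state4_phase3[of i] sum by (simp add: algebra_simps numeral_eq_Suc)
  then show ?thesis
    using row_disjoint_top[of P "B + P - 1" "B + Q + P + 2"] AB sum Suc
    by (simp add: state4_def algebra_simps numeral_eq_Suc)
qed

lemma state4_between:
  assumes "0 < k" "k < B + P + 2"
  shows "(row ^^ k) (state4 (A, P, B, Q)) \<notin> markers"
proof -
  consider j where "j < B" "k = Suc j" | "k = Suc B" | i where "i < P" "k = B + 2 + i"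
  proof -
    have "k \<le> B \<or> k = Suc B \<or> k \<ge> B + 2" by linarith
    then show ?thesis
      using that(1)[of "k - 1"] that(2) that(3)[of "k - B - 2"] assms by fastforce
  qed
  then show ?thesis
  proof cases
    case 1
    show ?thesis unfolding 1(2) state4_phase1[OF 1(1)] by (rule not_marker) (use AB in auto)
  next
    case 2
    show ?thesis unfolding 2 state4_phase2 by (rule not_marker) (use AB in auto)
  next
    case 3
    show ?thesis unfolding 3(2) state4_phase3[OF 3(1)] by (rule not_marker) (use AB in auto)
  qed
qed

lemma state4_marker: "state4 (A, P, B, Q) \<in> markers"
  unfolding state4_def split by (rule aligned_marker) (use AB sum in auto)

end

text \<open>Here \<open>d = b\<close> in the aligned state, and the next aligned states of the orbit arise by
  rotating \<open>(x, y, z)\<close>.\<close>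

definition state3 :: "nat \<times> nat \<times> nat \<Rightarrow> (nat \<times> nat) set" where
  "state3 = (\<lambda>(x, y, z). two_rows (z + 1) (x + z) (z + 1) (x + z))"

context
  fixes x y z :: nat
  assumes pos: "1 \<le> x" "1 \<le> y" "1 \<le> z" and sum: "x + y + z = n"
begin

text \<open>Equal right ends separate the rows in the first step; the disjoint intervals then shift
  until the first row reaches \<open>n\<close> at time \<open>y\<close>.\<close>

lemma state3_phase1:
  "i < y \<Longrightarrow> (row ^^ Suc i) (state3 (x, y, z)) = two_rows (z + 2 + i) (x + z + 1 + i) (1 + i) (z + i)"
proof (induction i)
  case 0
  then show ?case using row_same_end[of "z + 1" "z + 1" "x + z"] pos sum by (simp add: state3_def)
next
  case (Suc i)
  then show ?case
    using row_disjoint_shift[of "1 + i" "z + i" "z + 2 + i" "x + z + 1 + i"] pos sum by simp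
qed

lemma state3_return: "(row ^^ Suc y) (state3 (x, y, z)) = state3 (z, x, y)"
proof -
  obtain i where "y = Suc i" using pos by (cases y) auto
  then have "(row ^^ y) (state3 (x, y, z)) = two_rows (z + y + 1) n y (z + y - 1)"
    using state3_phase1[of i] sum by (simp add: algebra_simps)
  then show ?thesis
    \<comment> \<open>Exactly one column separates the two intervals, so the new first row coincides
      with the new second row.\<close>
    using row_disjoint_top[of y "z + y - 1" "z + y + 1"] pos sum
    by (simp add: state3_def algebra_simps)
qed

lemma state3_between:
  assumes "0 < k" "k < Suc y"
  shows "(row ^^ k) (state3 (x, y, z)) \<notin> markers"
proof -
  obtain i where i: "k = Suc i" "i < y" using assms by (cases k) auto
  show ?thesis
    unfolding i(1) state3_phase1[OF i(2)] by (rule not_marker) (use pos in auto)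
qed

lemma state3_marker: "state3 (x, y, z) \<in> markers"
  unfolding state3_def split by (rule aligned_marker) (use pos sum in auto)

end

end

section \<open>Counting orbits\<close>

context rectangle_rowmotion
begin

abbreviation exceptional :: "(nat \<times> nat) set" where
  "exceptional \<equiv> two_rows 1 0 n n"

definition shapes4 :: "(nat \<times> nat \<times> nat \<times> nat) set" where
  "shapes4 = {(A, P, B, Q). 1 \<le> A \<and> 1 \<le> B \<and> A + P + B + Q + 1 = n}"

definition shapes3 :: "(nat \<times> nat \<times> nat) set" where
  "shapes3 = {(x, y, z). 1 \<le> x \<and> 1 \<le> y \<and> 1 \<le> z \<and> x + y + z = n}"

text \<open>Lexicographic comparison of \<open>(A, P)\<close> with \<open>(B, Q)\<close> selects one
  tuple from each swapped pair and drops the tuples fixed by the swap.\<close>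

definition reps4 :: "(nat \<times> nat \<times> nat \<times> nat) set" where
  "reps4 = {(A, P, B, Q) \<in> shapes4. B < A \<or> B = A \<and> Q < P}"

text \<open>The first entry is minimal, and of two equal minima the cyclically first is chosen. Thus
  exactly one rotation of each nonconstant triple qualifies, and no constant one.\<close>

definition reps3 :: "(nat \<times> nat \<times> nat) set" where
  "reps3 = {(x, y, z) \<in> shapes3. x \<le> y \<and> x < z}"

lemma reps_subset: "reps4 \<subseteq> shapes4" "reps3 \<subseteq> shapes3"
  by (auto simp: reps4_def reps3_def)

lemma inj_state4: "inj_on state4 shapes4"
  by (auto simp: inj_on_def shapes4_def state4_def two_rows_eq_iff)

lemma inj_state3: "inj_on state3 shapes3"
  by (auto simp: inj_on_def shapes3_def state3_def two_rows_eq_iff)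

text \<open>The first row reaches further right than the second in \<open>state4\<close>, equally
  far in \<open>state3\<close>, and is empty in \<open>exceptional\<close>.\<close>

lemma states_distinct:
  "s \<in> shapes4 \<Longrightarrow> t \<in> shapes3 \<Longrightarrow> state4 s \<noteq> state3 t"
  "s \<in> shapes4 \<Longrightarrow> state4 s \<noteq> exceptional"
  "t \<in> shapes3 \<Longrightarrow> state3 t \<noteq> exceptional"
  by (auto simp: shapes4_def shapes3_def state4_def state3_def two_rows_eq_iff)

text \<open>The return times \<open>B + P + 2\<close> and \<open>A + Q + 2\<close> add up to
  \<open>n + 3\<close>; \<open>ne\<close> keeps the two markers distinct.\<close>

lemma orbit_state4:
  assumes s: "(A, P, B, Q) \<in> shapes4" and ne: "(A, P) \<noteq> (B, Q)"
  shows "card (orbit row (state4 (A, P, B, Q))) = n + 3"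
    and "orbit row (state4 (A, P, B, Q)) \<inter> markers = {state4 (A, P, B, Q), state4 (B, Q, A, P)}"
proof -
  define u where "u i = [state4 (A, P, B, Q), state4 (B, Q, A, P), state4 (A, P, B, Q)] ! i" for i
  define m where "m i = [B + P + 2, A + Q + 2] ! i" for i
  have AB: "1 \<le> A" "1 \<le> B" and sum: "A + P + B + Q + 1 = n" "B + Q + A + P + 1 = n"
    using s by (auto simp: shapes4_def)
  have ne': "state4 (A, P, B, Q) \<noteq> state4 (B, Q, A, P)"
    using inj_onD[OF inj_state4, of "(A, P, B, Q)" "(B, Q, A, P)"] ne s sum AB by (auto simp: shapes4_def)
  have lt2: "i < 2 \<longleftrightarrow> i = 0 \<or> i = 1" for i :: nat by auto
  have two: "{..<2} = {0, 1::nat}" by auto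
  note orb = orbit_markers[of 2 m row u markers]
  have "0 < m i" if "i < 2" for i using that by (auto simp: lt2 m_def)
  moreover have "(row ^^ m i) (u i) = u (Suc i)" if "i < 2" for i
    using that state4_return[OF AB sum(1)] state4_return[OF AB(2,1) sum(2)]
    unfolding lt2 m_def u_def by (auto simp del: funpow.simps)
  moreover have "(row ^^ k) (u i) \<notin> markers" if "i < 2" "0 < k" "k < m i" for i k
    using that state4_between[OF AB sum(1), of k] state4_between[OF AB(2,1) sum(2), of k]
    unfolding lt2 m_def u_def by (auto simp del: funpow.simps)
  moreover have "u i \<in> markers" if "i < 2" for i
    using that state4_marker[OF AB sum(1)] state4_marker[OF AB(2,1) sum(2)]
    unfolding lt2 m_def u_def by auto
  moreover have "u 2 = u 0" by (simp add: u_def)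
  moreover have "inj_on u {..<2}" using ne' by (auto simp: two u_def)
  ultimately have "card (orbit row (u 0)) = (\<Sum>i<2. m i)" "orbit row (u 0) \<inter> markers = u ` {..<2}"
    using orb by simp_all
  then show "card (orbit row (state4 (A, P, B, Q))) = n + 3"
    and "orbit row (state4 (A, P, B, Q)) \<inter> markers = {state4 (A, P, B, Q), state4 (B, Q, A, P)}"
    using sum by (auto simp: two u_def m_def)
qed

text \<open>The three return times are one more than the middle entries \<open>y\<close>,
  \<open>x\<close>, \<open>z\<close> of the successive rotations, with sum \<open>n + 3\<close>. A
  nonconstant triple has three different rotations.\<close>

lemma orbit_state3:
  assumes s: "(x, y, z) \<in> shapes3" and ne: "\<not> (x = y \<and> y = z)"
  shows "card (orbit row (state3 (x, y, z))) = n + 3"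
    and "orbit row (state3 (x, y, z)) \<inter> markers =
      {state3 (x, y, z), state3 (z, x, y), state3 (y, z, x)}"
proof -
  define u where "u i = [state3 (x, y, z), state3 (z, x, y), state3 (y, z, x), state3 (x, y, z)] ! i" for i
  define m where "m i = [Suc y, Suc x, Suc z] ! i" for i
  have pos: "1 \<le> x" "1 \<le> y" "1 \<le> z" and sum: "x + y + z = n" "z + x + y = n" "y + z + x = n"
    using s by (auto simp: shapes3_def)
  have ne': "state3 (x, y, z) \<noteq> state3 (z, x, y)" "state3 (x, y, z) \<noteq> state3 (y, z, x)"
    "state3 (z, x, y) \<noteq> state3 (y, z, x)"
    using inj_onD[OF inj_state3, of "(x, y, z)" "(z, x, y)"] inj_onD[OF inj_state3, of "(x, y, z)" "(y, z, x)"]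
      inj_onD[OF inj_state3, of "(z, x, y)" "(y, z, x)"] ne pos sum by (auto simp: shapes3_def)
  have lt3: "i < 3 \<longleftrightarrow> i = 0 \<or> i = 1 \<or> i = 2" for i :: nat by auto
  have three: "{..<3} = {0, 1, 2::nat}" by auto
  note facts = pos(1,2,3) sum(1) and facts' = pos(3,1,2) sum(2) and facts'' = pos(2,3,1) sum(3)
  have "0 < m i" if "i < 3" for i using that by (auto simp: lt3 m_def)
  moreover have "(row ^^ m i) (u i) = u (Suc i)" if "i < 3" for i
    using that state3_return[OF facts] state3_return[OF facts'] state3_return[OF facts'']
    unfolding lt3 m_def u_def by (auto simp del: funpow.simps)
  moreover have "(row ^^ k) (u i) \<notin> markers" if "i < 3" "0 < k" "k < m i" for i k
    using that state3_between[OF facts, of k] state3_between[OF facts', of k] state3_between[OF facts'', of k]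
    unfolding lt3 m_def u_def by (auto simp del: funpow.simps)
  moreover have "u i \<in> markers" if "i < 3" for i
    using that state3_marker[OF facts] state3_marker[OF facts'] state3_marker[OF facts'']
    unfolding lt3 m_def u_def by auto
  moreover have "u 3 = u 0" by (simp add: u_def)
  moreover have "inj_on u {..<3}" using ne' by (auto simp: three u_def)
  ultimately have "card (orbit row (u 0)) = (\<Sum>i<3. m i)" "orbit row (u 0) \<inter> markers = u ` {..<3}"
    using orbit_markers[of 3 m row u markers] by simp_all
  then show "card (orbit row (state3 (x, y, z))) = n + 3"
    and "orbit row (state3 (x, y, z)) \<inter> markers =
      {state3 (x, y, z), state3 (z, x, y), state3 (y, z, x)}"
    using sum by (auto simp: three u_def m_def)
qed

text \<open>Four special steps lead to the antichain of \<open>(1, 2)\<close> and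
  \<open>(2, 1)\<close>, which then shifts to the right.\<close>

lemma exceptional_phase:
  "i + 2 \<le> n \<Longrightarrow> (row ^^ (4 + i)) exceptional = two_rows (i + 2) (i + 2) (i + 1) (i + 1)"
proof (induction i)
  case 0
  then show ?case using row_exceptional by (simp add: numeral_eq_Suc)
next
  case (Suc i)
  have "(row ^^ (4 + Suc i)) exceptional = row ((row ^^ (4 + i)) exceptional)"
    by (simp only: add_Suc_right funpow.simps comp_apply)
  then show ?case using Suc row_disjoint_shift[of "i + 1" "i + 1" "i + 2" "i + 2"] by simp
qed

lemma orbit_exceptional:
  "card (orbit row exceptional) = n + 3" "orbit row exceptional \<inter> markers = {exceptional}"
proof -
  obtain i where i: "n = i + 2" using n_ge_2 by (metis add.commute le_Suc_ex)
  have return: "(row ^^ (n + 3)) exceptional = exceptional"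
    using exceptional_phase[of i] row_exceptional(5) i by (simp add: numeral_eq_Suc)
  have between: "(row ^^ k) exceptional \<notin> markers" if k: "0 < k" "k < n + 3" for k
  proof -
    consider "k = 1" | "k = 2" | "k = 3" | "4 \<le> k" using k by linarith
    then show ?thesis
    proof cases
      case 1
      then have "(row ^^ k) exceptional = two_rows 1 n 1 (n - 1)"
        using row_exceptional by simp
      then show ?thesis using not_marker[of 1 n 1 "n - 1"] n_ge_2 by simp
    next
      case 2
      then have "(row ^^ k) exceptional = two_rows 2 n 1 n"
        using row_exceptional by (simp add: numeral_eq_Suc)
      then show ?thesis using not_marker[of 2 n 1 n] n_ge_2 by simp
    next
      case 3
      then have "(row ^^ k) exceptional = two_rows 1 1 1 0"
        using row_exceptional by (simp add: numeral_eq_Suc)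
      \<comment> \<open>The second row is empty here, so \<open>not_marker\<close> does not apply;
        instead, every marker meets the second row.\<close>
      moreover have "I \<noteq> two_rows 1 1 1 0" if "I \<in> markers" for I
      proof -
        have "\<exists>j. (2, j) \<in> I" using that by (auto simp: markers_def two_rows_mem)
        then show ?thesis by (auto simp: two_rows_mem)
      qed
      ultimately show ?thesis by metis
    next
      case 4
      then obtain j where "k = 4 + j" by (metis le_Suc_ex)
      then show ?thesis using exceptional_phase[of j] k not_marker[of "j + 2" "j + 2" "j + 1" "j + 1"] by simp
    qed
  qed
  have "exceptional \<in> markers" by (simp add: markers_def)
  moreover have one: "{..<1} = {0::nat}" by auto
  ultimately have "card (orbit row exceptional) = (\<Sum>i<1::nat. n + 3)"
    "orbit row exceptional \<inter> markers = (\<lambda>_. exceptional) ` {..<1::nat}"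
    using return between
    by (intro orbit_markers[of 1 "\<lambda>_. n + 3" row "\<lambda>_. exceptional" markers]; simp)+
  then show "card (orbit row exceptional) = n + 3" "orbit row exceptional \<inter> markers = {exceptional}"
    unfolding one by simp_all
qed

section \<open>Distinct representatives have distinct orbits\<close>

definition reps :: "(nat \<times> nat) set set" where
  "reps = insert exceptional (state4 ` reps4 \<union> state3 ` reps3)"

lemma reps_ICS: "reps \<subseteq> interval_closed_sets (rectangle_poset 2 n)"
  using n_ge_2
  by (auto simp: reps_def reps4_def reps3_def shapes4_def shapes3_def state4_def state3_def intro!: two_rows_ICS)

lemma card_orbit_reps: "u \<in> reps \<Longrightarrow> card (orbit row u) = n + 3"
  using orbit_exceptional orbit_state4(1) orbit_state3(1)
  by (fastforce simp: reps_def reps4_def reps3_def)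

text \<open>The markers in an orbit are the cyclic shifts of one tuple, and only one shift is a
  representative. So a representative can be recovered from its orbit, which makes
  \<open>orbit row\<close> injective on \<open>reps\<close>.\<close>

lemma orbit_reps_markers:
  assumes "u \<in> reps"
  shows "orbit row u \<inter> markers \<inter> reps = {u}"
proof -
  consider "u = exceptional" | A P B Q where "u = state4 (A, P, B, Q)" "(A, P, B, Q) \<in> reps4"
    | x y z where "u = state3 (x, y, z)" "(x, y, z) \<in> reps3"
    using assms by (auto simp: reps_def)
  then show ?thesis
  proof cases
    case 1
    then show ?thesis using orbit_exceptional(2) by (simp add: reps_def)
  next
    case (2 A P B Q)
    have r: "(A, P, B, Q) \<in> shapes4" "(A, P) \<noteq> (B, Q)" "(B, Q, A, P) \<in> shapes4" "(B, Q, A, P) \<notin> reps4"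
      using 2(2) by (auto simp: reps4_def shapes4_def)
    have "state4 (B, Q, A, P) \<notin> state4 ` reps4"
      using inj_on_image_mem_iff[OF inj_state4 r(3) reps_subset(1)] r(4) by blast
    then have "state4 (B, Q, A, P) \<notin> reps"
      using states_distinct(1)[OF r(3)] states_distinct(2)[OF r(3)] reps_subset(2)
      unfolding reps_def by blast
    then show ?thesis using orbit_state4(2)[OF r(1,2)] assms 2(1) by auto
  next
    case (3 x y z)
    have r: "(x, y, z) \<in> shapes3" "\<not> (x = y \<and> y = z)" "(z, x, y) \<in> shapes3" "(y, z, x) \<in> shapes3"
        "(z, x, y) \<notin> reps3" "(y, z, x) \<notin> reps3"
      using 3(2) by (auto simp: reps3_def shapes3_def)
    have "state3 (z, x, y) \<notin> state3 ` reps3" "state3 (y, z, x) \<notin> state3 ` reps3"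
      using inj_on_image_mem_iff[OF inj_state3 _ reps_subset(2)] r by blast+
    then have "state3 (z, x, y) \<notin> reps" "state3 (y, z, x) \<notin> reps"
      using states_distinct(1)[OF _ r(3)] states_distinct(1)[OF _ r(4)]
        states_distinct(3)[OF r(3)] states_distinct(3)[OF r(4)] reps_subset(1)
      unfolding reps_def by fastforce+
    then show ?thesis using orbit_state3(2)[OF r(1,2)] assms 3(1) by auto
  qed
qed

section \<open>Counting tuples up to symmetry\<close>

lemma finite_shapes: "finite shapes4" "finite shapes3"
proof -
  have "shapes4 \<subseteq> {..n} \<times> {..n} \<times> {..n} \<times> {..n}" by (auto simp: shapes4_def)
  then show "finite shapes4" by (rule finite_subset) simp
  have "shapes3 \<subseteq> {..n} \<times> {..n} \<times> {..n}" by (auto simp: shapes3_def)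
  then show "finite shapes3" by (rule finite_subset) simp
qed

lemma finite_reps: "finite reps4" "finite reps3"
  using finite_shapes by (auto simp: reps4_def reps3_def intro: finite_subset[rotated])

lemma card_reps: "card reps = 1 + card reps4 + card reps3"
proof -
  note sub = reps_subset
  have "card (state4 ` reps4 \<union> state3 ` reps3) = card reps4 + card reps3"
  proof (subst card_Un_disjoint)
    show "state4 ` reps4 \<inter> state3 ` reps3 = {}" using states_distinct(1) sub by blast
  qed (use finite_reps in \<open>auto simp: card_image inj_on_subset[OF inj_state4 sub(1)] inj_on_subset[OF inj_state3 sub(2)]\<close>)
  moreover have "exceptional \<notin> state4 ` reps4 \<union> state3 ` reps3"
    using states_distinct(2,3) sub by (auto, metis subsetD, metis subsetD)
  ultimately show ?thesis unfolding reps_def using finite_reps by simp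
qed

lemma num_rowmotion_orbits_ge:
  "card reps \<le> num_rowmotion_orbits (rectangle_poset 2 n) xs (n + 3)"
proof -
  have "finite (Pow (rectangle_poset 2 n))" by (simp add: rectangle_poset_def)
  moreover have "interval_closed_sets (rectangle_poset 2 n) \<subseteq> Pow (rectangle_poset 2 n)"
    by (auto simp: interval_closed_sets_def)
  ultimately have "finite (rowmotion_orbits (rectangle_poset 2 n) xs)"
    unfolding rowmotion_orbits_def using finite_subset by blast
  moreover have "orbit row ` reps \<subseteq> {B \<in> rowmotion_orbits (rectangle_poset 2 n) xs. card B = n + 3}"
    unfolding rowmotion_orbits_def using reps_ICS card_orbit_reps by blast
  moreover have "inj_on (orbit row) reps"
    using orbit_reps_markers by (metis inj_onI singleton_inject)
  ultimately show ?thesis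
    unfolding num_rowmotion_orbits_def by (simp add: card_inj_on_le)
qed

text \<open>Stars and bars: lowering \<open>A\<close> and \<open>B\<close> by 1 leaves four natural
  numbers with sum \<open>n - 3\<close>. For \<open>n < 3\<close> the binomial coefficient is
  0.\<close>

lemma card_shapes4_ge: "n choose 3 \<le> card shapes4"
proof (cases "3 \<le> n")
  case True
  define g where "g l = (Suc (l ! 0), l ! 1, Suc (l ! 2), l ! 3)" for l :: "nat list"
  let ?L = "{l::nat list. length l = 4 \<and> sum_list l = n - 3}"
  have "inj_on g ?L"
    by (auto simp: inj_on_def g_def list_eq_iff_nth_eq numeral_eq_Suc less_Suc_eq)
  moreover have "g ` ?L \<subseteq> shapes4"
    using True by (auto simp: g_def shapes4_def numeral_eq_Suc length_Suc_conv)
  ultimately have "card ?L \<le> card shapes4" using finite_shapes(1) by (rule card_inj_on_le)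
  moreover have "card ?L = n choose (n - 3)" using True by (simp add: card_length_sum_list)
  ultimately show ?thesis using binomial_symmetric[OF True] by simp
qed (simp add: not_le binomial_eq_0)

text \<open>Stars and bars again, with all three entries lowered by 1.\<close>

lemma card_shapes3_ge: "(n - 1) choose 2 \<le> card shapes3"
proof (cases "3 \<le> n")
  case True
  define g where "g l = (Suc (l ! 0), Suc (l ! 1), Suc (l ! 2))" for l :: "nat list"
  let ?L = "{l::nat list. length l = 3 \<and> sum_list l = n - 3}"
  have "inj_on g ?L"
    by (auto simp: inj_on_def g_def list_eq_iff_nth_eq numeral_eq_Suc less_Suc_eq)
  moreover have "g ` ?L \<subseteq> shapes3"
    using True by (auto simp: g_def shapes3_def numeral_eq_Suc length_Suc_conv)
  ultimately have "card ?L \<le> card shapes3" using finite_shapes(2) by (rule card_inj_on_le)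
  moreover have "card ?L = (n - 1) choose (n - 3)" using True by (simp add: card_length_sum_list)
  moreover have "n - 1 - 2 = n - 3" by simp
  ultimately show ?thesis using binomial_symmetric[of 2 "n - 1"] True by simp
qed (simp add: not_le binomial_eq_0)

text \<open>Each tuple is a representative, the swap of one, or fixed by the swap.\<close>

lemma card_shapes4_le: "card shapes4 \<le> 2 * card reps4 + (if odd n then (n - 1) div 2 else 0)"
proof -
  let ?swap = "\<lambda>(A, P, B, Q). (B, Q, A, P)"
  \<comment> \<open>A fixed tuple \<open>(A, P, A, P)\<close> satisfies
    \<open>2 * (A + P) + 1 = n\<close>, so \<open>n\<close> is odd and \<open>A\<close> determines
    \<open>P\<close>.\<close>
  let ?F = "if odd n then (\<lambda>A. (A, (n - 1) div 2 - A, A, (n - 1) div 2 - A)) ` {1..(n - 1) div 2} else {}"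
  have cover: "shapes4 \<subseteq> reps4 \<union> ?swap ` reps4 \<union> ?F"
  proof
    fix s assume that: "s \<in> shapes4"
    obtain A P B Q where s: "s = (A, P, B, Q)" by (cases s) auto
    have v: "1 \<le> A" "1 \<le> B" "A + P + B + Q + 1 = n" using that s by (auto simp: shapes4_def)
    consider "B < A \<or> B = A \<and> Q < P" | "A < B \<or> A = B \<and> P < Q" | "A = B" "P = Q" by linarith
    then show "s \<in> reps4 \<union> ?swap ` reps4 \<union> ?F"
    proof cases
      case 1
      then show "s \<in> reps4 \<union> ?swap ` reps4 \<union> ?F" using that s by (auto simp: reps4_def)
    next
      case 2
      then have "(B, Q, A, P) \<in> reps4" using v by (auto simp: reps4_def shapes4_def)
      then show "s \<in> reps4 \<union> ?swap ` reps4 \<union> ?F" using s by force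
    next
      case 3
      then have n: "n = 2 * (A + P) + 1" using v by simp
      then have "odd n" "(n - 1) div 2 = A + P" by auto
      then show "s \<in> reps4 \<union> ?swap ` reps4 \<union> ?F" using s 3 v by (auto simp: image_iff intro!: bexI[of _ A])
    qed
  qed
  have "card shapes4 \<le> card (reps4 \<union> ?swap ` reps4 \<union> ?F)"
    using finite_reps by (intro card_mono[OF _ cover]) simp
  also have "\<dots> \<le> card reps4 + card (?swap ` reps4) + card ?F"
    by (meson add_le_mono card_Un_le order_refl order_trans)
  also have "card (?swap ` reps4) \<le> card reps4" using finite_reps by (intro card_image_le)
  also have "card ?F \<le> (if odd n then (n - 1) div 2 else 0)"
    using card_image_le[of "{1..(n - 1) div 2}" "\<lambda>A. (A, (n - 1) div 2 - A, A, (n - 1) div 2 - A)"] by simp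
  finally show ?thesis by simp
qed

text \<open>Placing the minimum first shows that each triple is a rotation of a representative or
  constant; a constant triple exists only if 3 divides \<open>n\<close>.\<close>

lemma card_shapes3_le: "card shapes3 \<le> 3 * card reps3 + (if 3 dvd n then 1 else 0)"
proof -
  let ?rot = "\<lambda>(x, y, z). (z, x, y)"
  let ?rot2 = "\<lambda>(x, y, z). (y, z, x)"
  let ?F = "if 3 dvd n then {(n div 3, n div 3, n div 3)} else {}"
  have cover: "shapes3 \<subseteq> reps3 \<union> ?rot ` reps3 \<union> ?rot2 ` reps3 \<union> ?F"
  proof
    fix s assume that: "s \<in> shapes3"
    obtain x y z where s: "s = (x, y, z)" by (cases s) auto
    have v: "1 \<le> x" "1 \<le> y" "1 \<le> z" "x + y + z = n" using that s by (auto simp: shapes3_def)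
    consider "x \<le> y" "x < z" | "y \<le> z" "y < x" | "z \<le> x" "z < y" | "x = y" "y = z" by linarith
    then show "s \<in> reps3 \<union> ?rot ` reps3 \<union> ?rot2 ` reps3 \<union> ?F"
    proof cases
      case 1
      then show "s \<in> reps3 \<union> ?rot ` reps3 \<union> ?rot2 ` reps3 \<union> ?F" using that s by (auto simp: reps3_def)
    next
      case 2
      then have "(y, z, x) \<in> reps3" using v by (auto simp: reps3_def shapes3_def)
      then show "s \<in> reps3 \<union> ?rot ` reps3 \<union> ?rot2 ` reps3 \<union> ?F" using s by force
    next
      case 3
      then have "(z, x, y) \<in> reps3" using v by (auto simp: reps3_def shapes3_def)
      then show "s \<in> reps3 \<union> ?rot ` reps3 \<union> ?rot2 ` reps3 \<union> ?F" using s by force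
    next
      case 4
      then have "n = 3 * x" using v by simp
      then show "s \<in> reps3 \<union> ?rot ` reps3 \<union> ?rot2 ` reps3 \<union> ?F" using s 4 by auto
    qed
  qed
  have "card shapes3 \<le> card (reps3 \<union> ?rot ` reps3 \<union> ?rot2 ` reps3 \<union> ?F)"
    using finite_reps by (intro card_mono[OF _ cover]) simp
  also have "\<dots> \<le> card reps3 + card (?rot ` reps3) + card (?rot2 ` reps3) + card ?F"
    by (meson add_le_mono card_Un_le order_refl order_trans)
  also have "card (?rot ` reps3) \<le> card reps3" using finite_reps by (intro card_image_le)
  also have "card (?rot2 ` reps3) \<le> card reps3" using finite_reps by (intro card_image_le)
  finally show ?thesis by (cases "3 dvd n") simp_all
qed

text \<open>All residues at once: 12 times \<open>1 + card reps4 + card reps3\<close> is bounded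
  below by \<open>12 + 6 * (n choose 3) + 4 * ((n - 1) choose 2)\<close> minus the corrections for
  symmetric tuples.\<close>

lemma num_rowmotion_orbits_bound:
  "real n ^ 3 - real n ^ 2 - 4 * real n + 16 \<le>
     12 * real (num_rowmotion_orbits (rectangle_poset 2 n) xs (n + 3)) +
     (if odd n then 3 * real n - 3 else 0) + (if 3 dvd n then 4 else 0)"
proof -
  \<comment> \<open>Writing \<open>n\<close> as \<open>m + 2\<close> avoids truncated subtraction in
    the binomial identities.\<close>
  obtain m where m: "n = m + 2" using n_ge_2 by (metis add.commute le_Suc_ex)
  have c2: "2 * ((m + 1) choose 2) = (m + 1) * m"
    using Suc_times_binomial[of 1 m] by (simp add: eval_nat_numeral)
  have "3 * ((m + 2) choose 3) = (m + 2) * ((m + 1) choose 2)"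
    using Suc_times_binomial[of 2 "m + 1"] by (simp add: eval_nat_numeral)
  then have c3: "6 * ((m + 2) choose 3) = (m + 2) * (m + 1) * m"
    using c2 by (metis (no_types, opaque_lifting) mult.assoc mult.left_commute mult_2 numeral_Bit0 distrib_right)
  have "(m + 2) * (m + 1) * m + 2 * ((m + 1) * m) + 12 \<le>
      12 * card reps + 6 * (if odd n then (n - 1) div 2 else 0) + 4 * (if 3 dvd n then 1 else 0)"
    using card_shapes4_ge card_shapes4_le card_shapes3_ge card_shapes3_le card_reps c3 c2
    by (simp add: m)
  also have "6 * (if odd n then (n - 1) div 2 else 0) = (if odd n then 3 * (m + 1) else 0)"
    using m by (auto elim!: oddE)
  finally have "(m + 2) * (m + 1) * m + 2 * ((m + 1) * m) + 12 \<le>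
      12 * num_rowmotion_orbits (rectangle_poset 2 n) xs (n + 3) +
      (if odd n then 3 * (m + 1) else 0) + (if 3 dvd n then 4 else 0)"
    using num_rowmotion_orbits_ge by auto
  then have "real ((m + 2) * (m + 1) * m + 2 * ((m + 1) * m) + 12) \<le>
      real (12 * num_rowmotion_orbits (rectangle_poset 2 n) xs (n + 3) +
      (if odd n then 3 * (m + 1) else 0) + (if 3 dvd n then 4 else 0))"
    by (rule of_nat_mono)
  moreover have "real ((m + 2) * (m + 1) * m + 2 * ((m + 1) * m) + 12) =
      real n ^ 3 - real n ^ 2 - 4 * real n + 16"
    by (simp add: m power3_eq_cube power2_eq_square algebra_simps)
  ultimately show ?thesis using m by (auto split: if_splits)
qed

end

section \<open>The six residue classes modulo 6\<close>

theorem theorem3p7: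
  fixes n :: nat and xs :: "(nat \<times> nat) list"
  assumes "n \<ge> 2"
    and "linear_extension (rectangle_poset 2 n) xs"
  shows "(n mod 6 = 0 \<longrightarrow> real (num_rowmotion_orbits (rectangle_poset 2 n) xs (n + 3)) \<ge>
            (real n ^ 3 - real n ^ 2 - 4 * real n + 12) / 12) \<and>
         (n mod 6 = 1 \<longrightarrow> real (num_rowmotion_orbits (rectangle_poset 2 n) xs (n + 3)) \<ge>
            (real n ^ 3 - real n ^ 2 - 7 * real n + 19) / 12) \<and>
         (n mod 6 = 2 \<longrightarrow> real (num_rowmotion_orbits (rectangle_poset 2 n) xs (n + 3)) \<ge>
            (real n ^ 3 - real n ^ 2 - 4 * real n + 16) / 12) \<and>
         (n mod 6 = 3 \<longrightarrow> real (num_rowmotion_orbits (rectangle_poset 2 n) xs (n + 3)) \<ge>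
            (real n ^ 3 - real n ^ 2 - 7 * real n + 15) / 12) \<and>
         (n mod 6 = 4 \<longrightarrow> real (num_rowmotion_orbits (rectangle_poset 2 n) xs (n + 3)) \<ge>
            (real n ^ 3 - real n ^ 2 - 4 * real n + 16) / 12) \<and>
         (n mod 6 = 5 \<longrightarrow> real (num_rowmotion_orbits (rectangle_poset 2 n) xs (n + 3)) \<ge>
            (real n ^ 3 - real n ^ 2 - 7 * real n + 19) / 12)"
proof -
  interpret rectangle_rowmotion n xs
    using assms by unfold_locales
  define N where "N = real (num_rowmotion_orbits (rectangle_poset 2 n) xs (n + 3))"
  have bound: "real n ^ 3 - real n ^ 2 - 4 * real n + 16 \<le>
      12 * N + (if odd n then 3 * real n - 3 else 0) + (if 3 dvd n then 4 else 0)"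
    using num_rowmotion_orbits_bound unfolding N_def .
  \<comment> \<open>The residue modulo 6 decides both corrections, parity and divisibility by
    3.\<close>
  have odd: "odd n \<longleftrightarrow> n mod 6 = 1 \<or> n mod 6 = 3 \<or> n mod 6 = 5"
    and dvd: "3 dvd n \<longleftrightarrow> n mod 6 = 0 \<or> n mod 6 = 3"
    by presburger+
  show ?thesis
    using bound unfolding N_def[symmetric] odd dvd
    by (intro conjI impI; simp add: field_simps)
qed



end
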